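(* In Version B, the $\mathcal{P}$-positions with exactly $5$ (nonempty) piles are precisely the positions of one of the following forms (the order of the piles is irrelevant): \begin{itemize} \item $1, 1, e_2, e_2, e_2$; \item $1, 1, e_2, o_1, o_1$; \item $1, 2, e_2, e_2, o_3$; \item $1, e_4, e_4, o_5, o_5$; \item $e_2, e_2, e_2, e_2, e_2$; \item $e_2, o_3, o_3, o_3, o_3$; \item $e_2, e_2, e_2, o_3, o_3$, except those of the form $2, e_4, e_4, o_5, o_5$ (which are not $\mathcal{P}$-positions). \end{itemize}
   Context: Version B is a two-player impartial game. A position consists of finitely many piles of tokens; empty piles are ignored. The players alternate turns; on a turn, a player either removes a single token from any one nonempty pile, or removes one token from each (nonempty) pile. The last player to move wins. A position is a $\mathcal{P}$-position if the player who is not about to move has a winning strategy, equivalently if none of its options (positions reachable in one move) is a $\mathcal{P}$-position; otherwise it is an $\mathcal{N}$-position. A position is written as the list of its pile sizes. Notation: $e_k$ (respectively $o_k$) denotes any even (respectively odd) pile of size at least $k$; different occurrences of the same symbol in a list may stand for different sizes. *)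

theory Defs
  imports "HOL-Library.Multiset"
begin

text \<open>
  A position is the multiset of its pile sizes. Entries equal to 0 are permitted and stand for
  empty piles: they are not affected by any move, and only nonempty piles are counted.
\<close>

definition nonempty_piles :: "nat multiset \<Rightarrow> nat multiset" where
  "nonempty_piles G = filter_mset (\<lambda>n. 0 < n) G"

text \<open>
  In the second rule truncated subtraction leaves the empty piles empty; the premise
  rules out the move that would remove nothing.
\<close>

inductive move :: "nat multiset \<Rightarrow> nat multiset \<Rightarrow> bool" where
  move_one: "move (add_mset (Suc n) G) (add_mset n G)"
| move_all: "nonempty_piles G \<noteq> {#} \<Longrightarrow> move G (image_mset (\<lambda>n. n - 1) G)"

lemma sum_mset_pred_le: "(\<Sum>n\<in>#G. n - 1) \<le> \<Sum>\<^sub># (G :: nat multiset)"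
  by (induction G) auto

lemma move_decreases:
  assumes "move G H"
  shows "\<Sum>\<^sub># H < \<Sum>\<^sub># G"
  using assms
proof cases
  case (move_one n K)
  then show ?thesis by simp
next
  case move_all
  then obtain m where "m \<in># G" "0 < m"
    by (auto simp: nonempty_piles_def filter_mset_eq_conv)
  then obtain K where "G = add_mset m K"
    by (meson mset_add)
  with move_all \<open>0 < m\<close> sum_mset_pred_le[of K] show ?thesis
    by simp
qed

text \<open>
  Normal play: a position without moves is a P-position, since the player about to move loses.
\<close>

function P_position :: "nat multiset \<Rightarrow> bool" where
  "P_position G \<longleftrightarrow> (\<forall>H. move G H \<longrightarrow> \<not> P_position H)"
  by auto
termination
  by (relation "measure sum_mset") (auto intro: move_decreases)

text \<open>The equation rewrites its own right-hand side, so it must not be a simplification rule.\<close>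

declare P_position.simps [simp del]

text \<open>
  The sets of admissible values of the symbols \<open>e\<^sub>k\<close> and \<open>o\<^sub>k\<close>. Distinct occurrences of a
  symbol may take distinct values, hence a form is a list of sets of pile sizes.
\<close>

definition evens_from :: "nat \<Rightarrow> nat set" where
  "evens_from k = {n. even n \<and> k \<le> n}"

definition odds_from :: "nat \<Rightarrow> nat set" where
  "odds_from k = {n. odd n \<and> k \<le> n}"

definition of_form :: "nat multiset \<Rightarrow> nat set list \<Rightarrow> bool" where
  "of_form G Ss \<longleftrightarrow> (\<exists>xs. mset xs = G \<and> list_all2 (\<in>) xs Ss)"

end

theory Submission
  imports Defs
begin

text \<open>
  Whether a position with at most five piles is a P-position depends only on how many of its piles
  have size 1, 2, 3, even size at least 4, and odd size at least 5. Removing one token from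
  a pile sends each class into a single class, or to an empty pile, except that an even pile of size
  at least 4 becomes a 3 or an odd pile of size at least 5 according to
  whether it equals 4. Separating the piles of size 4 therefore makes every option determined by six
  counts with sum at most 5, and the recursion defining P-positions reduces to a check of finitely
  many cases.
\<close>

text \<open>
  The arguments are the numbers of piles of size 1, 2, 3, even size at least 4, and odd size at
  least 5. The predicate is meant for at most five piles in total, which is why any number of
  even piles is accepted when there is no odd pile.
\<close>

definition P_counts :: "nat \<Rightarrow> nat \<Rightarrow> nat \<Rightarrow> nat \<Rightarrow> nat \<Rightarrow> bool" where
  "P_counts a b c d e \<longleftrightarrow> (let p = b + d; q = a + c + e in
     q = 0
     \<or> p = 1 \<and> q = 2
     \<or> p = 2 \<and> q = 2 \<and> a = 2
     \<or> p = 1 \<and> q = 3 \<and> a = 0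
     \<or> p = 1 \<and> q = 4 \<and> a \<noteq> 1
     \<or> p = 3 \<and> q = 2 \<and> (a = 2 \<or> a = 1 \<and> 0 < b \<or> a = 0 \<and> \<not> (b = 1 \<and> c = 0))
     \<or> p = 2 \<and> q = 3 \<and> a = 1 \<and> b = 0 \<and> c = 0)"

text \<open>
  Here \<open>k\<close> counts the piles of size 4 and \<open>f\<close> the even piles of size at least 6.
\<close>

definition P_option :: "nat \<Rightarrow> nat \<Rightarrow> nat \<Rightarrow> nat \<Rightarrow> nat \<Rightarrow> nat \<Rightarrow> bool" where
  "P_option a b c k f e \<longleftrightarrow>
     0 < a \<and> P_counts (a - 1) b c (k + f) e
   \<or> 0 < b \<and> P_counts (a + 1) (b - 1) c (k + f) e
   \<or> 0 < c \<and> P_counts a (b + 1) (c - 1) (k + f) e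
   \<or> 0 < k \<and> P_counts a b (c + 1) (k + f - 1) e
   \<or> 0 < f \<and> P_counts a b c (k + f - 1) (e + 1)
   \<or> 0 < e \<and> P_counts a b c (k + f + 1) (e - 1)
   \<or> 0 < b + (k + f) + (a + (c + e)) \<and> P_counts b c k e f"

text \<open>This is the recursion defining P-positions, stated for counts; only finitely many tuples
  satisfy the bound, so evaluation settles it.\<close>

lemma P_counts_iff_no_P_option:
  assumes "a + b + c + k + f + e \<le> 5"
  shows "P_counts a b c (k + f) e \<longleftrightarrow> \<not> P_option a b c k f e"
proof -
  \<comment> \<open>The shrinking ranges list exactly the tuples with sum at most 5;
    \<open>list_all\<close> makes the bounded quantifiers executable.\<close>
  have *: "list_all (\<lambda>a. list_all (\<lambda>b. list_all (\<lambda>c. list_all (\<lambda>k. list_all (\<lambda>f. list_all (\<lambda>e.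
      P_counts a b c (k + f) e \<longleftrightarrow> \<not> P_option a b c k f e)
      [0..<6-a-b-c-k-f]) [0..<6-a-b-c-k]) [0..<6-a-b-c]) [0..<6-a-b]) [0..<6-a]) [0..<6]"
    by code_simp
  show ?thesis
    by (rule *[unfolded list_all_iff, rule_format]) (use assms in simp_all)
qed

section \<open>Counting the piles whose size lies in a given set\<close>

definition num_in :: "'a set \<Rightarrow> 'a multiset \<Rightarrow> nat" where
  "num_in S G = size (filter_mset (\<lambda>n. n \<in> S) G)"

lemma num_in_empty [simp]: "num_in S {#} = 0"
  by (simp add: num_in_def)

lemma num_in_add_mset [simp]:
  "num_in S (add_mset n G) = (if n \<in> S then Suc (num_in S G) else num_in S G)"
  by (simp add: num_in_def)

lemma num_in_pos_obtain:
  assumes "0 < num_in S G"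
  obtains n K where "n \<in> S" "G = add_mset n K"
proof -
  have "filter_mset (\<lambda>n. n \<in> S) G \<noteq> {#}"
    using assms by (metis less_numeral_extra(3) num_in_def size_empty)
  then obtain n where "n \<in># filter_mset (\<lambda>n. n \<in> S) G"
    by auto
  then have "n \<in> S" "n \<in># G" by simp_all
  with that show thesis by (meson mset_add)
qed

text \<open>Read from left to right, these equations reduce every count to the six classes 1, 2, 3,
  4, even from 6 and odd from 5.\<close>

lemma num_in_split:
  "num_in (evens_from 2) G = count G 2 + num_in (evens_from 4) G"
  "num_in (evens_from 4) G = count G 4 + num_in (evens_from 6) G"
  "num_in (odds_from 1) G = count G 1 + num_in (odds_from 3) G"
  "num_in (odds_from 3) G = count G 3 + num_in (odds_from 5) G"
  "size (nonempty_piles G) = num_in (evens_from 2) G + num_in (odds_from 1) G"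
  by (induction G; simp add: nonempty_piles_def evens_from_def odds_from_def; presburger)+

lemma num_in_nonempty_piles: "0 \<notin> S \<Longrightarrow> num_in S (nonempty_piles G) = num_in S G"
  by (induction G) (auto simp: nonempty_piles_def)

lemma num_in_image_mset: "num_in S (image_mset f G) = num_in (f -` S) G"
  by (induction G) auto

lemma count_conv_num_in: "count G x = num_in {x} G"
  by (induction G) auto

section \<open>Moves seen through the counts\<close>

definition P_class :: "nat multiset \<Rightarrow> bool" where
  "P_class G \<longleftrightarrow> P_counts (count G 1) (count G 2) (count G 3)
     (num_in (evens_from 4) G) (num_in (odds_from 5) G)"

text \<open>Removing a token from each pile shifts the classes: 1 vanishes, 2, 3, 4 step down by
  one, odd from 5 becomes even from 4, and even from 6 becomes odd from 5. This accounts for the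
  last disjunct of \<open>P_option\<close>.\<close>

lemma P_class_image_pred:
  "P_class (image_mset (\<lambda>n. n - 1) G) \<longleftrightarrow>
     P_counts (count G 2) (count G 3) (count G 4) (num_in (odds_from 5) G) (num_in (evens_from 6) G)"
proof -
  let ?f = "\<lambda>n. n - 1 :: nat"
  \<comment> \<open>No set on the left contains 0, so truncation at 0 adds nothing to the
    preimages.\<close>
  have "?f -` {1} = {2}" "?f -` {2} = {3}" "?f -` {3} = {4}"
    "?f -` evens_from 4 = odds_from 5" "?f -` odds_from 5 = evens_from 6"
    by (auto simp: evens_from_def odds_from_def; presburger)+
  then show ?thesis
    unfolding P_class_def count_conv_num_in num_in_image_mset by simp
qed

lemma ex_move_P_class_iff:
  "(\<exists>H. move G H \<and> P_class H) \<longleftrightarrow>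
     P_option (count G 1) (count G 2) (count G 3) (count G 4)
       (num_in (evens_from 6) G) (num_in (odds_from 5) G)"
  (is "?L \<longleftrightarrow> ?R")
proof
  note defs = P_class_def P_option_def evens_from_def odds_from_def num_in_split(2)[unfolded evens_from_def]
  assume ?L
  then obtain H where "move G H" "P_class H" by blast
  then show ?R
  proof cases
    case (move_one n K)
    \<comment> \<open>Here \<open>n\<close> is the size after the move. The moved pile
      \<open>Suc n\<close> is thus 1, 2, 3, 4, even from 6, or odd from 5, matching the first six
      disjuncts of \<open>P_option\<close>.\<close>
    consider "n = 0" | "n = 1" | "n = 2" | "n = 3" | "4 \<le> n" "odd n" | "4 \<le> n" "even n"
      by linarith
    then show ?thesis
    proof cases
      case 5
      then have "5 \<le> n" by presburger
      with 5 move_one \<open>P_class H\<close> show ?thesis by (simp add: defs)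
    next
      case 6
      with move_one \<open>P_class H\<close> show ?thesis by (simp add: defs)
    qed (use move_one \<open>P_class H\<close> in \<open>simp_all add: defs\<close>)
  next
    case move_all
    then have "0 < size (nonempty_piles G)" "P_class (image_mset (\<lambda>n. n - 1) G)"
      using \<open>P_class H\<close> by (simp_all add: nonempty_has_size)
    then show ?thesis
      unfolding P_option_def P_class_image_pred num_in_split by blast
  qed
next
  note defs = P_class_def evens_from_def odds_from_def
  have one: ?L if "G = add_mset (Suc n) K" "P_class (add_mset n K)" for n K
    using that move_one by blast
  assume ?R
  \<comment> \<open>The disjuncts of \<open>P_option\<close>, with the piles of size 4 merged back
    into \<open>evens_from 4\<close> and positive counts of single sizes turned into
    membership.\<close>
  then consider
      "1 \<in># G" "P_counts (count G 1 - 1) (count G 2) (count G 3) (num_in (evens_from 4) G) (num_in (odds_from 5) G)"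
    | "2 \<in># G" "P_counts (count G 1 + 1) (count G 2 - 1) (count G 3) (num_in (evens_from 4) G) (num_in (odds_from 5) G)"
    | "3 \<in># G" "P_counts (count G 1) (count G 2 + 1) (count G 3 - 1) (num_in (evens_from 4) G) (num_in (odds_from 5) G)"
    | "4 \<in># G" "P_counts (count G 1) (count G 2) (count G 3 + 1) (num_in (evens_from 4) G - 1) (num_in (odds_from 5) G)"
    | "0 < num_in (evens_from 6) G"
      "P_counts (count G 1) (count G 2) (count G 3) (num_in (evens_from 4) G - 1) (num_in (odds_from 5) G + 1)"
    | "0 < num_in (odds_from 5) G"
      "P_counts (count G 1) (count G 2) (count G 3) (num_in (evens_from 4) G + 1) (num_in (odds_from 5) G - 1)"
    | "0 < size (nonempty_piles G)" "P_class (image_mset (\<lambda>n. n - 1) G)"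
    unfolding P_option_def P_class_image_pred num_in_split count_greater_zero_iff[symmetric]
    by (elim disjE conjE) presburger+
  then show ?L
  proof cases
    case 1
    then obtain K where "G = add_mset 1 K" by (meson mset_add)
    with 1 show ?thesis by (intro one[of 0 K]) (simp_all add: defs)
  next
    case 2
    then obtain K where "G = add_mset 2 K" by (meson mset_add)
    with 2 show ?thesis by (intro one[of 1 K]) (simp_all add: defs)
  next
    case 3
    then obtain K where "G = add_mset 3 K" by (meson mset_add)
    with 3 show ?thesis by (intro one[of 2 K]) (simp_all add: defs)
  next
    case 4
    then obtain K where "G = add_mset 4 K" by (meson mset_add)
    with 4 show ?thesis by (intro one[of 3 K]) (simp_all add: defs)
  next
    case 5
    then obtain n K where n: "n \<in> evens_from 6" "G = add_mset n K"
      by (elim num_in_pos_obtain)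
    then obtain m where "n = Suc m" "odd m" "5 \<le> m"
      by (cases n) (auto simp: evens_from_def)
    with 5 n show ?thesis by (intro one[of m K]) (simp_all add: defs)
  next
    case 6
    then obtain n K where n: "n \<in> odds_from 5" "G = add_mset n K"
      by (elim num_in_pos_obtain)
    then obtain m where "n = Suc m" "even m" "4 \<le> m"
      by (cases n) (auto simp: odds_from_def)
    with 6 n show ?thesis by (intro one[of m K]) (simp_all add: defs)
  next
    case 7
    then have "nonempty_piles G \<noteq> {#}" by auto
    with 7 move_all show ?thesis by blast
  qed
qed

text \<open>Options inherit the bound on the number of piles, so an induction hypothesis restricted
  to at most five piles applies to them.\<close>

lemma size_nonempty_piles_move:
  assumes "move G H"
  shows "size (nonempty_piles H) \<le> size (nonempty_piles G)"
  using assms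
proof cases
  case move_all
  have "size (nonempty_piles (image_mset (\<lambda>n. n - 1) G)) \<le> size (nonempty_piles G)"
    by (induction G) (auto simp: nonempty_piles_def)
  with move_all show ?thesis by simp
qed (simp add: nonempty_piles_def)

text \<open>Induction along the game: by hypothesis \<open>P_class\<close> is correct on all
  options, \<open>ex_move_P_class_iff\<close> expresses these by counts, and the finite check closes
  the recursion. The bound is at most five because moves may empty piles.\<close>

lemma P_position_iff_P_class:
  assumes "size (nonempty_piles G) \<le> 5"
  shows "P_position G \<longleftrightarrow> P_class G"
  using assms
proof (induction G rule: P_position.induct)
  case (1 G)
  have "P_position G \<longleftrightarrow> \<not> (\<exists>H. move G H \<and> P_class H)"
    using 1 size_nonempty_piles_move order_trans by (subst P_position.simps) blast
  also have "\<dots> \<longleftrightarrow> P_class G"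
    unfolding ex_move_P_class_iff unfolding P_class_def num_in_split(2)
    using 1(2)[unfolded num_in_split] by (intro P_counts_iff_no_P_option[symmetric]) simp
  finally show ?case .
qed

section \<open>Forms as conditions on counts\<close>

lemma of_form_Nil: "of_form G [] \<longleftrightarrow> G = {#}"
  by (auto simp: of_form_def)

lemma of_form_Cons: "of_form G (S # Ss) \<longleftrightarrow> (\<exists>x\<in>S. x \<in># G \<and> of_form (G - {#x#}) Ss)"
proof
  assume "of_form G (S # Ss)"
  then show "\<exists>x\<in>S. x \<in># G \<and> of_form (G - {#x#}) Ss"
    by (fastforce simp: of_form_def list_all2_Cons2)
next
  assume "\<exists>x\<in>S. x \<in># G \<and> of_form (G - {#x#}) Ss"
  then obtain x xs where "x \<in> S" "x \<in># G" "mset xs = G - {#x#}" "list_all2 (\<in>) xs Ss"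
    by (auto simp: of_form_def)
  then show "of_form G (S # Ss)"
    unfolding of_form_def by (intro exI[of _ "x # xs"]) simp
qed

text \<open>The counting step for filling one slot of a form: by disjointness, removing a pile in
  \<open>S\<close> leaves the count for \<open>T\<close> unchanged.\<close>

lemma ex_diff_single_num_in_iff:
  assumes "S \<inter> T = {}"
  shows "(\<exists>x\<in>S. x \<in># G \<and> size (G - {#x#}) = k \<and> num_in S (G - {#x#}) = m \<and> num_in T (G - {#x#}) = n)
    \<longleftrightarrow> size G = Suc k \<and> num_in S G = Suc m \<and> num_in T G = n" (is "?L \<longleftrightarrow> ?R")
proof
  assume ?L
  then obtain x where x: "x \<in> S" "x \<in># G" "size (G - {#x#}) = k"
    "num_in S (G - {#x#}) = m" "num_in T (G - {#x#}) = n" by blast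
  moreover obtain K where "G = add_mset x K"
    using x by (meson mset_add)
  moreover have "x \<notin> T" using assms x by blast
  ultimately show ?R by simp
next
  assume R: ?R
  then have "0 < num_in S G" by simp
  then obtain x K where "x \<in> S" "G = add_mset x K"
    by (elim num_in_pos_obtain)
  moreover have "x \<notin> T" using assms calculation by blast
  ultimately show ?L using R by (intro bexI[of _ x]) simp_all
qed

text \<open>Since the sets are disjoint, no pile can fill slots of both blocks, so counting decides
  the matching; the size condition excludes piles outside both sets.\<close>

lemma of_form_two_blocks:
  assumes "S \<inter> T = {}"
  shows "of_form G (replicate m S @ replicate n T) \<longleftrightarrow>
    size G = m + n \<and> num_in S G = m \<and> num_in T G = n"
proof (induction m arbitrary: G)
  case 0
  show ?case
  proof (induction n arbitrary: G)
    case 0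
    show ?case by (auto simp: of_form_Nil)
  next
    case (Suc n)
    then show ?case
      \<comment> \<open>The sets swap roles: a pile in \<open>T\<close> is removed while the count
        for \<open>S\<close> stays 0.\<close>
      using ex_diff_single_num_in_iff[of T S G n n 0] assms
      by (simp add: of_form_Cons Int_commute conj_commute cong: conj_cong)
  qed
next
  case (Suc m)
  then show ?case
    using ex_diff_single_num_in_iff[of S T G "m + n" m n] assms
    by (simp add: of_form_Cons)
qed

lemma num_in_diff:
  assumes "N \<subseteq># G"
  shows "num_in S (G - N) = num_in S G - num_in S N"
proof -
  obtain K where "G = K + N"
    using assms by (metis subset_mset.diff_add)
  then show ?thesis by (simp add: num_in_def)
qed

lemma num_in_mono: "N \<subseteq># G \<Longrightarrow> num_in S N \<le> num_in S G"
  unfolding num_in_def by (intro size_mset_mono multiset_filter_mono)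

lemma of_form_singletons:
  "of_form G (map (\<lambda>x. {x}) xs @ Ss) \<longleftrightarrow> mset xs \<subseteq># G \<and> of_form (G - mset xs) Ss"
  by (induction xs arbitrary: G) (auto simp: of_form_Cons insert_subset_eq_iff)

text \<open>All eight forms in the theorem have this shape: fixed sizes, then even slots, then odd
  slots. A fixed size may itself lie in one of the sets, hence the correction terms for
  \<open>mset xs\<close>.\<close>

lemma of_form_singletons_evens_odds:
  "of_form G (map (\<lambda>x. {x}) xs @ replicate m (evens_from k) @ replicate n (odds_from j)) \<longleftrightarrow>
    mset xs \<subseteq># G \<and> size G = length xs + m + n \<and>
    num_in (evens_from k) G = m + num_in (evens_from k) (mset xs) \<and>
    num_in (odds_from j) G = n + num_in (odds_from j) (mset xs)"
proof (cases "mset xs \<subseteq># G")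
  case True
  have "evens_from k \<inter> odds_from j = {}"
    by (auto simp: evens_from_def odds_from_def)
  with True show ?thesis
    using size_mset_mono[OF True]
      num_in_mono[OF True, of "evens_from k"] num_in_mono[OF True, of "odds_from j"]
    by (auto simp: of_form_singletons of_form_two_blocks num_in_diff size_Diff_submset)
qed (simp add: of_form_singletons)

section \<open>The case of exactly five piles\<close>

text \<open>The disjuncts translate the seven forms of the theorem in order, the negated part being
  the exception; again a finite check by evaluation.\<close>

lemma P_counts_five_piles_iff:
  assumes "a + b + c + d + e = 5"
  shows "P_counts a b c d e \<longleftrightarrow>
      1 < a \<and> b + d = 3 \<and> a + c + e = 2
    \<or> 1 < a \<and> b + d = 1 \<and> a + c + e = 4
    \<or> 0 < a \<and> 0 < b \<and> b + d = 3 \<and> c + e = 1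
    \<or> 0 < a \<and> d = 2 \<and> e = 2
    \<or> b + d = 5 \<and> a + c + e = 0
    \<or> b + d = 1 \<and> c + e = 4
    \<or> b + d = 3 \<and> c + e = 2 \<and> \<not> (0 < b \<and> d = 2 \<and> e = 2)"
    (is "_ \<longleftrightarrow> ?R a b c d e")
proof -
  have *: "list_all (\<lambda>a. list_all (\<lambda>b. list_all (\<lambda>c. list_all (\<lambda>d. list_all (\<lambda>e.
      a + b + c + d + e = 5 \<longrightarrow> P_counts a b c d e = ?R a b c d e)
      [0..<6-a-b-c-d]) [0..<6-a-b-c]) [0..<6-a-b]) [0..<6-a]) [0..<6]"
    by code_simp
  show ?thesis
    by (rule *[unfolded list_all_iff, rule_format]) (use assms in simp_all)
qed

theorem lemma2p5:
  fixes G :: "nat multiset"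
  assumes "size (nonempty_piles G) = 5"
  shows "P_position G \<longleftrightarrow>
      of_form (nonempty_piles G) [{1}, {1}, evens_from 2, evens_from 2, evens_from 2]
    \<or> of_form (nonempty_piles G) [{1}, {1}, evens_from 2, odds_from 1, odds_from 1]
    \<or> of_form (nonempty_piles G) [{1}, {2}, evens_from 2, evens_from 2, odds_from 3]
    \<or> of_form (nonempty_piles G) [{1}, evens_from 4, evens_from 4, odds_from 5, odds_from 5]
    \<or> of_form (nonempty_piles G) [evens_from 2, evens_from 2, evens_from 2, evens_from 2, evens_from 2]
    \<or> of_form (nonempty_piles G) [evens_from 2, odds_from 3, odds_from 3, odds_from 3, odds_from 3]
    \<or> (of_form (nonempty_piles G) [evens_from 2, evens_from 2, evens_from 2, odds_from 3, odds_from 3]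
        \<and> \<not> of_form (nonempty_piles G) [{2}, evens_from 4, evens_from 4, odds_from 5, odds_from 5])"
proof -
  define M where "M = nonempty_piles G"
  define a b c d e where "a = count M 1" and "b = count M 2" and "c = count M 3"
    and "d = num_in (evens_from 4) M" and "e = num_in (odds_from 5) M"
  note defs = a_def b_def c_def d_def e_def
  \<comment> \<open>With this, the last equation of \<open>num_in_split\<close> for \<open>M\<close>
    makes the five counts add up to 5.\<close>
  have "nonempty_piles M = M"
    by (simp add: M_def nonempty_piles_def filter_filter_mset)
  moreover have "size M = 5"
    using assms by (simp add: M_def)
  ultimately have size: "size M = 5" "a + b + c + d + e = 5"
    using num_in_split[of M] by (simp_all add: defs)
  have split: "num_in (evens_from 2) M = b + d" "num_in (odds_from 1) M = a + c + e"
    "num_in (odds_from 3) M = c + e" "num_in (evens_from 4) M = d" "num_in (odds_from 5) M = e"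
    unfolding num_in_split defs by simp_all
  have subset: "1 \<in># M \<longleftrightarrow> 0 < a" "2 \<in># M \<longleftrightarrow> 0 < b" "{#1, 1#} \<subseteq># M \<longleftrightarrow> 1 < a"
    "{#1, 2#} \<subseteq># M \<longleftrightarrow> 0 < a \<and> 0 < b"
    by (auto simp: defs insert_subset_eq_iff simp flip: count_greater_zero_iff)
  \<comment> \<open>Empty piles do not matter, since 0 lies in none of the counted classes.\<close>
  have "P_position G \<longleftrightarrow> P_class M"
    using assms P_position_iff_P_class[of G]
    by (simp add: M_def P_class_def num_in_nonempty_piles count_conv_num_in evens_from_def odds_from_def)
  also have "\<dots> \<longleftrightarrow> P_counts a b c d e"
    by (simp add: P_class_def defs)
  finally have P: "P_position G \<longleftrightarrow> P_counts a b c d e" .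
  have in_sets: "1 \<notin> evens_from k" "1 \<in> odds_from 1" "1 \<notin> odds_from 3" "1 \<notin> odds_from 5"
    "2 \<notin> odds_from k" "2 \<in> evens_from 2" "2 \<notin> evens_from 4" for k
    by (auto simp: evens_from_def odds_from_def)
  \<comment> \<open>Successor form lets the simplifier unfold \<open>replicate\<close>; likewise
    \<open>One_nat_def\<close> puts the rules below into the form that simplification
    produces.\<close>
  let ?two = "Suc (Suc 0)"
  note form = of_form_singletons_evens_odds[of M]
  note rules = size(1) subset[unfolded One_nat_def] split[unfolded One_nat_def]
    in_sets[unfolded One_nat_def]
  have
    "of_form M [{1}, {1}, evens_from 2, evens_from 2, evens_from 2] \<longleftrightarrow>
      1 < a \<and> b + d = 3 \<and> a + c + e = 2"
    \<comment> \<open>The odd block is empty; its bound 1 yields the condition that the two fixed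
      piles of size 1 are the only odd ones.\<close>
    using form[of "[1, 1]" "Suc ?two" 2 0 1] by (auto simp: rules)
  moreover have
    "of_form M [{1}, {1}, evens_from 2, odds_from 1, odds_from 1] \<longleftrightarrow>
      1 < a \<and> b + d = 1 \<and> a + c + e = 4"
    using form[of "[1, 1]" 1 2 ?two 1] by (auto simp: rules)
  moreover have
    "of_form M [{1}, {2}, evens_from 2, evens_from 2, odds_from 3] \<longleftrightarrow>
      0 < a \<and> 0 < b \<and> b + d = 3 \<and> c + e = 1"
    using form[of "[1, 2]" ?two 2 1 3] by (auto simp: rules)
  moreover have
    "of_form M [{1}, evens_from 4, evens_from 4, odds_from 5, odds_from 5] \<longleftrightarrow>
      0 < a \<and> d = 2 \<and> e = 2"
    using form[of "[1]" ?two 4 ?two 5] by (auto simp: rules)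
  moreover have
    "of_form M [evens_from 2, evens_from 2, evens_from 2, evens_from 2, evens_from 2] \<longleftrightarrow>
      b + d = 5 \<and> a + c + e = 0"
    using form[of "[]" "Suc (?two + ?two)" 2 0 1] by (auto simp: rules)
  moreover have
    "of_form M [evens_from 2, odds_from 3, odds_from 3, odds_from 3, odds_from 3] \<longleftrightarrow>
      b + d = 1 \<and> c + e = 4"
    using form[of "[]" 1 2 "?two + ?two" 3] by (auto simp: rules)
  moreover have
    "of_form M [evens_from 2, evens_from 2, evens_from 2, odds_from 3, odds_from 3] \<longleftrightarrow>
      b + d = 3 \<and> c + e = 2"
    using form[of "[]" "Suc ?two" 2 ?two 3] by (auto simp: rules)
  moreover have
    "of_form M [{2}, evens_from 4, evens_from 4, odds_from 5, odds_from 5] \<longleftrightarrow>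
      0 < b \<and> d = 2 \<and> e = 2"
    using form[of "[2]" ?two 4 ?two 5] by (auto simp: rules)
  ultimately show ?thesis
    unfolding P M_def[symmetric] P_counts_five_piles_iff[OF size(2)] by simp
qed

end
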